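(* Let $d\in\mathbb N$, $a\in\mathbb N_0$. For all integers $n\ge m\ge 0$, $$\widehat{S1p}(d,a;n,m)=a^{n-m}\sum_{j=m}^n\binom{j}{m}\sum_{k=0}^{n-j}\binom{n+k-1}{j-1}\binom{2n-j}{n-j-k}\,a^k\sum_{l=0}^{n-j+k}(-1)^l\binom{n-j+k}{l}\,a^{-l}\,\widehat{S2}(d,a;l,k).$$ The formula also holds for $a=0$, where the powers of $a$ in each term are combined to $a^{n-m+k-l}$, which becomes $\delta_{0,n-m+k-l}$ (from $0^0=1$).
   Context: $\mathbb N=\{1,2,\dots\}$, $\mathbb N_0=\{0,1,2,\dots\}$, $0^0:=1$, $\delta$ is the Kronecker symbol, and binomial coefficients are $\binom{r}{k}=r(r-1)\cdots(r-k+1)/k!$ for integers $k\ge0$ and $\binom{r}{k}=0$ for integers $k<0$. The generalized Stirling numbers of the second kind $S2(d,a;n,m)$, $0\le m\le n$, are defined by the operator identity $(a\,\mathbf 1+d\,\mathbf E_x)^n=\sum_{m=0}^n S2(d,a;n,m)\,x^m\,\mathbf d_x^{\,m}$, where $\mathbf d_x$ is differentiation with respect to $x$, $\mathbf E_x:=x\,\mathbf d_x$ and $\mathbf 1$ is the identity operator; $S2(d,a;n,m):=0$ for $m>n$. The scaled numbers are $\widehat{S2}(d,a;n,m):=S2(d,a;n,m)/d^m$. Let $\mathbf{S1}[d,a]=(S1(d,a;n,m))_{n,m\ge0}$ be the inverse of the infinite lower triangular matrix $\mathbf{S2}[d,a]=(S2(d,a;n,m))_{n,m\ge0}$, and set 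$\widehat{S1p}(d,a;n,m):=d^n\,(-1)^{n-m}\,S1(d,a;n,m)$.
   Formalization: The case n = m = 0 is excluded: there the left side is 1, while the right side's only term contains the binomial coefficient with upper and lower entries −1, which is 0 by the stated convention, so the formula fails there. *)

theory Defs
  imports "HOL-Computational_Algebra.Polynomial"
begin

text \<open>
  Differential operators act on polynomials with rational coefficients. This loses nothing: an
  operator of the form \<open>\<Sum>m\<le>n. c m x^m (d/dx)^m\<close> is determined by its action on polynomials
  (see \<open>S2_ex1\<close>).
\<close>

definition euler_op :: "rat poly \<Rightarrow> rat poly" where
  "euler_op p = [:0, 1:] * pderiv p"

definition affine_euler_op :: "nat \<Rightarrow> nat \<Rightarrow> rat poly \<Rightarrow> rat poly" where
  "affine_euler_op d a p = smult (of_nat a) p + smult (of_nat d) (euler_op p)"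

definition is_S2_row :: "nat \<Rightarrow> nat \<Rightarrow> nat \<Rightarrow> (nat \<Rightarrow> rat) \<Rightarrow> bool" where
  "is_S2_row d a n c \<longleftrightarrow>
     (\<forall>p. (affine_euler_op d a ^^ n) p =
          (\<Sum>m\<le>n. smult (c m) ([:0, 1:] ^ m * (pderiv ^^ m) p))) \<and>
     (\<forall>m>n. c m = 0)"

definition S2 :: "nat \<Rightarrow> nat \<Rightarrow> nat \<Rightarrow> nat \<Rightarrow> rat" where
  "S2 d a n = (THE c. is_S2_row d a n c)"

definition S2_hat :: "nat \<Rightarrow> nat \<Rightarrow> nat \<Rightarrow> nat \<Rightarrow> rat" where
  "S2_hat d a n m = S2 d a n m / of_nat d ^ m"

definition lower_triangular :: "(nat \<Rightarrow> nat \<Rightarrow> rat) \<Rightarrow> bool" where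
  "lower_triangular A \<longleftrightarrow> (\<forall>n m. n < m \<longrightarrow> A n m = 0)"

text \<open>
  The product of infinite matrices whose left factor is lower triangular; all omitted terms
  vanish.
\<close>

definition lt_mult :: "(nat \<Rightarrow> nat \<Rightarrow> rat) \<Rightarrow> (nat \<Rightarrow> nat \<Rightarrow> rat) \<Rightarrow> nat \<Rightarrow> nat \<Rightarrow> rat" where
  "lt_mult A B = (\<lambda>n m. \<Sum>k\<le>n. A n k * B k m)"

definition id_mat :: "nat \<Rightarrow> nat \<Rightarrow> rat" where
  "id_mat = (\<lambda>n m. if n = m then 1 else 0)"

definition S1 :: "nat \<Rightarrow> nat \<Rightarrow> nat \<Rightarrow> nat \<Rightarrow> rat" where
  "S1 d a = (THE T. lower_triangular T \<and>
                    lt_mult (S2 d a) T = id_mat \<and> lt_mult T (S2 d a) = id_mat)"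

definition S1p_hat :: "nat \<Rightarrow> nat \<Rightarrow> nat \<Rightarrow> nat \<Rightarrow> rat" where
  "S1p_hat d a n m = of_nat d ^ n * (- 1) ^ (n - m) * S1 d a n m"

text \<open>
  Binomial coefficients with integer arguments, vanishing for every negative lower argument. In
  particular \<open>binom (-1) (-1) = 0\<close>. This matters for the expansion of \<open>S1p_hat d a n m\<close> studied
  here: for \<open>n = m = 0\<close> its only term has the factor \<open>binom (-1) (-1)\<close>, so its value is \<open>0\<close>, whereas
  \<open>S1p_hat d a 0 0 = 1\<close>. The pair \<open>(0, 0)\<close> therefore has to be excluded.
\<close>

definition binom :: "int \<Rightarrow> int \<Rightarrow> rat" where
  "binom r k = (if k < 0 then 0 else of_int r gchoose nat k)"


subsection \<open>The definite descriptions are meaningful\<close>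

lemma pderiv_X_power_mult:
  fixes q :: "rat poly"
  shows "[:0, 1:] * pderiv ([:0, 1:] ^ m * q) =
         smult (of_nat m) ([:0, 1:] ^ m * q) + [:0, 1:] ^ Suc m * pderiv q"
proof (induction m)
  case (Suc m)
  have X: "pderiv [:0, 1 :: rat:] = 1" by (simp add: pderiv_pCons)
  have "[:0, 1:] * pderiv ([:0, 1:] ^ Suc m * q) =
        [:0, 1:] * pderiv ([:0, 1:] * ([:0, 1:] ^ m * q))"
    by (simp only: power_Suc mult.assoc)
  also have "\<dots> = [:0, 1:] * ([:0, 1:] * pderiv ([:0, 1:] ^ m * q) + [:0, 1:] ^ m * q)"
    unfolding pderiv_mult [of "[:0, 1:]"] X by simp
  also have "\<dots> = smult (of_nat (Suc m)) ([:0, 1:] ^ Suc m * q) + [:0, 1:] ^ Suc (Suc m) * pderiv q"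
    unfolding Suc.IH by (simp add: algebra_simps smult_add_left smult_add_right)
  finally show ?case .
qed simp

lemma affine_euler_op_term:
  "affine_euler_op d a (smult c ([:0, 1:] ^ m * (pderiv ^^ m) p)) =
   smult ((of_nat a + of_nat d * of_nat m) * c) ([:0, 1:] ^ m * (pderiv ^^ m) p) +
   smult (of_nat d * c) ([:0, 1:] ^ Suc m * (pderiv ^^ Suc m) p)"
proof -
  have "euler_op (smult c ([:0, 1:] ^ m * (pderiv ^^ m) p)) =
        smult c ([:0, 1:] * pderiv ([:0, 1:] ^ m * (pderiv ^^ m) p))"
    by (simp add: euler_op_def pderiv_smult)
  then show ?thesis
    unfolding affine_euler_op_def pderiv_X_power_mult
    by (simp add: smult_add_left smult_add_right algebra_simps)
qed

lemma affine_euler_op_sum: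
  "affine_euler_op d a (sum f A) = (\<Sum>x\<in>A. affine_euler_op d a (f x))"
proof -
  have add: "affine_euler_op d a (p + q) = affine_euler_op d a p + affine_euler_op d a q" for p q
    by (simp add: affine_euler_op_def euler_op_def pderiv_add smult_add_right algebra_simps)
  have "affine_euler_op d a 0 = 0" by (simp add: affine_euler_op_def euler_op_def)
  with add show ?thesis by (induction A rule: infinite_finite_induct) simp_all
qed

lemma is_S2_row_0: "is_S2_row d a 0 (\<lambda>m. if m = 0 then 1 else 0)"
  by (simp add: is_S2_row_def)

lemma is_S2_row_Suc:
  assumes "is_S2_row d a n c"
  shows "is_S2_row d a (Suc n) (\<lambda>m. (of_nat a + of_nat d * of_nat m) * c m +
           (if m = 0 then 0 else of_nat d * c (m - 1)))"
proof -
  let ?t = "\<lambda>m p. [:0, 1:] ^ m * (pderiv ^^ m) p :: rat poly"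
  have c0: "c (Suc n) = 0" using assms by (simp add: is_S2_row_def)
  have "(affine_euler_op d a ^^ Suc n) p =
        (\<Sum>m\<le>Suc n. smult ((of_nat a + of_nat d * of_nat m) * c m +
           (if m = 0 then 0 else of_nat d * c (m - 1))) (?t m p))" for p
  proof -
    have "(affine_euler_op d a ^^ Suc n) p =
          affine_euler_op d a (\<Sum>m\<le>n. smult (c m) (?t m p))"
      using assms by (simp add: is_S2_row_def)
    also have "\<dots> = (\<Sum>m\<le>n. smult ((of_nat a + of_nat d * of_nat m) * c m) (?t m p)) +
                    (\<Sum>m\<le>n. smult (of_nat d * c m) (?t (Suc m) p))"
      unfolding affine_euler_op_sum affine_euler_op_term sum.distrib ..
    also have "(\<Sum>m\<le>n. smult ((of_nat a + of_nat d * of_nat m) * c m) (?t m p)) =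
               (\<Sum>m\<le>Suc n. smult ((of_nat a + of_nat d * of_nat m) * c m) (?t m p))"
      by (simp add: c0)
    also have "(\<Sum>m\<le>n. smult (of_nat d * c m) (?t (Suc m) p)) =
               (\<Sum>m\<le>Suc n. smult (if m = 0 then 0 else of_nat d * c (m - 1)) (?t m p))"
      by (simp add: sum.atMost_Suc_shift del: sum.atMost_Suc funpow.simps power_Suc)
    finally show ?thesis unfolding smult_add_left sum.distrib .
  qed
  then show ?thesis using assms by (simp add: is_S2_row_def)
qed

lemma pderiv_power_monom: "(pderiv ^^ k) (monom (c::rat) k) = [:c * fact k:]"
proof (induction k arbitrary: c)
  case (Suc k)
  have "(pderiv ^^ Suc k) (monom c (Suc k)) = (pderiv ^^ k) (monom (of_nat (Suc k) * c) k)"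
    by (simp add: funpow_Suc_right pderiv_monom del: funpow.simps)
  then show ?case using Suc.IH by (simp add: algebra_simps)
qed (simp add: monom_0)

lemma is_S2_row_unique:
  assumes "is_S2_row d a n c" "is_S2_row d a n c'"
  shows "c = c'"
proof
  fix k
  show "c k = c' k"
  proof (induction k rule: less_induct)
    case (less k)
    show ?case
    proof (cases "k \<le> n")
      case True
      let ?v = "\<lambda>m. poly ((pderiv ^^ m) (monom (1::rat) k)) 1"
      have vpos: "?v k \<noteq> 0"
        by (simp add: pderiv_power_monom)
      have vz: "?v m = 0" if "m > k" for m
      proof -
        from that obtain i where "m = Suc i + k" by (metis less_iff_Suc_add add.commute add_Suc_right add_Suc)
        then have "(pderiv ^^ m) (monom (1::rat) k) = (pderiv ^^ Suc i) [:fact k:]"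
          by (simp only: funpow_add o_apply pderiv_power_monom) simp
        also have "\<dots> = 0"
          by (simp add: funpow_Suc_right pderiv_pCons del: funpow.simps)
        finally show ?thesis by simp
      qed
      have eq: "(\<Sum>m\<le>n. e m * ?v m) = (\<Sum>m<k. e m * ?v m) + e k * ?v k" for e
      proof -
        have "(\<Sum>m\<le>n. e m * ?v m) = (\<Sum>m\<le>k. e m * ?v m)"
          using True by (intro sum.mono_neutral_right) (auto simp: vz)
        then show ?thesis by (simp add: lessThan_Suc_atMost [symmetric])
      qed
      have ev: "poly ((affine_euler_op d a ^^ n) (monom 1 k)) 1 = (\<Sum>m\<le>n. e m * ?v m)"
        if "is_S2_row d a n e" for e
        using that by (simp add: is_S2_row_def poly_sum)
      have "(\<Sum>m<k. c m * ?v m) + c k * ?v k = (\<Sum>m<k. c' m * ?v m) + c' k * ?v k"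
        using ev [OF assms(1)] ev [OF assms(2)] eq by simp
      moreover have "(\<Sum>m<k. c m * ?v m) = (\<Sum>m<k. c' m * ?v m)"
        by (intro sum.cong) (simp_all add: less.IH)
      ultimately show ?thesis using vpos by simp
    qed (use assms in \<open>simp add: is_S2_row_def\<close>)
  qed
qed

lemma S2_ex1: "\<exists>!c. is_S2_row d a n c"
proof -
  have "\<exists>c. is_S2_row d a n c"
    by (induction n) (use is_S2_row_0 is_S2_row_Suc in blast)+
  then show ?thesis using is_S2_row_unique by blast
qed

lemma is_S2_row_S2: "is_S2_row d a n (S2 d a n)"
  unfolding S2_def by (rule theI' [OF S2_ex1])

lemma S2_0: "S2 d a 0 = (\<lambda>m. if m = 0 then 1 else 0)"
  using is_S2_row_unique [OF is_S2_row_S2 is_S2_row_0] .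

lemma S2_Suc: "S2 d a (Suc n) = (\<lambda>m. (of_nat a + of_nat d * of_nat m) * S2 d a n m +
    (if m = 0 then 0 else of_nat d * S2 d a n (m - 1)))"
  using is_S2_row_unique [OF is_S2_row_S2 is_S2_row_Suc [OF is_S2_row_S2]] .

lemma lower_triangular_S2: "lower_triangular (S2 d a)"
  using is_S2_row_S2 by (auto simp: lower_triangular_def is_S2_row_def)

lemma S2_diag: "S2 d a n n = of_nat d ^ n"
proof (induction n)
  case (Suc n)
  have "S2 d a n (Suc n) = 0" using lower_triangular_S2 by (simp add: lower_triangular_def)
  with Suc show ?case by (simp add: S2_Suc)
qed (simp add: S2_0)

fun lt_inv :: "(nat \<Rightarrow> nat \<Rightarrow> rat) \<Rightarrow> nat \<Rightarrow> nat \<Rightarrow> rat" where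
  "lt_inv A n m = (id_mat n m - (\<Sum>k\<in>{..<n}. A n k * lt_inv A k m)) / A n n"

declare lt_inv.simps [simp del]

lemma lower_triangular_lt_inv: "lower_triangular (lt_inv A)"
proof -
  have "n < m \<Longrightarrow> lt_inv A n m = 0" for n m
  proof (induction n rule: less_induct)
    case (less n)
    then have "(\<Sum>k<n. A n k * lt_inv A k m) = 0" by (intro sum.neutral) auto
    with less.prems show ?case by (simp add: lt_inv.simps [of A n m] id_mat_def)
  qed
  then show ?thesis by (simp add: lower_triangular_def)
qed

lemma lt_inv_right:
  assumes "\<And>n. A n n \<noteq> 0"
  shows "lt_mult A (lt_inv A) = id_mat"
proof (intro ext)
  fix n m
  have "lt_mult A (lt_inv A) n m = (\<Sum>k<n. A n k * lt_inv A k m) + A n n * lt_inv A n m"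
    by (simp add: lt_mult_def lessThan_Suc_atMost [symmetric])
  then show "lt_mult A (lt_inv A) n m = id_mat n m"
    using assms [of n] by (simp add: lt_inv.simps [of A n m])
qed

lemma lt_inv_diag: "lt_inv A n n = 1 / A n n"
proof -
  have "(\<Sum>k<n. A n k * lt_inv A k n) = 0"
    using lower_triangular_lt_inv [of A] by (intro sum.neutral) (auto simp: lower_triangular_def)
  then show ?thesis by (simp add: lt_inv.simps [of A n n] id_mat_def)
qed

lemma lt_mult_assoc:
  assumes "lower_triangular B"
  shows "lt_mult (lt_mult A B) C = lt_mult A (lt_mult B C)"
proof (intro ext)
  fix n m
  have "(\<Sum>k\<le>i. B i k * C k m) = (\<Sum>k\<le>n. B i k * C k m)" if "i \<le> n" for i
    using that assms by (intro sum.mono_neutral_left) (auto simp: lower_triangular_def)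
  then have "lt_mult A (lt_mult B C) n m = (\<Sum>i\<le>n. A n i * (\<Sum>k\<le>n. B i k * C k m))"
    by (simp add: lt_mult_def)
  also have "\<dots> = (\<Sum>i\<le>n. \<Sum>k\<le>n. A n i * B i k * C k m)"
    by (simp add: sum_distrib_left mult.assoc)
  also have "\<dots> = (\<Sum>k\<le>n. \<Sum>i\<le>n. A n i * B i k * C k m)" by (rule sum.swap)
  also have "\<dots> = lt_mult (lt_mult A B) C n m" by (simp add: lt_mult_def sum_distrib_right)
  finally show "lt_mult (lt_mult A B) C n m = lt_mult A (lt_mult B C) n m" by simp
qed

lemma lt_mult_id_left: "lt_mult id_mat A = A"
  by (intro ext) (simp add: lt_mult_def id_mat_def if_distrib [of "\<lambda>x. x * _"] cong: if_cong)

lemma lt_mult_id_right: "lower_triangular A \<Longrightarrow> lt_mult A id_mat = A"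
  by (intro ext) (auto simp: lt_mult_def id_mat_def lower_triangular_def
      if_distrib [of "\<lambda>x. _ * x"] cong: if_cong)

lemma S1_ex1:
  assumes "d \<ge> 1"
  shows "\<exists>!T. lower_triangular T \<and> lt_mult (S2 d a) T = id_mat \<and> lt_mult T (S2 d a) = id_mat"
proof
  let ?A = "S2 d a" and ?T = "lt_inv (S2 d a)"
  have nz: "?A n n \<noteq> 0" for n using assms by (simp add: S2_diag)
  have T: "lt_mult ?A ?T = id_mat" using nz by (rule lt_inv_right)
  have U: "lt_mult ?T (lt_inv ?T) = id_mat" using nz by (intro lt_inv_right) (simp add: lt_inv_diag)
  have "lt_inv ?T = lt_mult (lt_mult ?A ?T) (lt_inv ?T)" by (simp add: T lt_mult_id_left)
  also have "\<dots> = ?A"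
    by (simp add: lt_mult_assoc lower_triangular_lt_inv U lt_mult_id_right lower_triangular_S2)
  finally have "lt_mult ?T ?A = id_mat" using U by simp
  then show "lower_triangular ?T \<and> lt_mult ?A ?T = id_mat \<and> lt_mult ?T ?A = id_mat"
    using T lower_triangular_lt_inv by blast
  fix V assume V: "lower_triangular V \<and> lt_mult ?A V = id_mat \<and> lt_mult V ?A = id_mat"
  have "V = lt_mult V (lt_mult ?A ?T)" using V by (simp add: T lt_mult_id_right)
  also have "\<dots> = lt_mult (lt_mult V ?A) ?T" by (simp add: lt_mult_assoc lower_triangular_S2)
  also have "\<dots> = ?T" using V by (simp add: lt_mult_id_left)
  finally show "V = ?T" .
qed

end

(* Substituting S2_hat's recurrence into the binomial transform over l removes the shift a and leaves
   (-1)^(n-j+k) d^(n-j) S(n-j+k, k) with an ordinary Stirling number. As S1p_hat d a n m is the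
   coefficient of x^m in the product of the x + a + i d for i < n, it equals the sum over j of
   (j choose m) a^(j-m) d^(n-j) c(n, j). The claim thus reduces to Schloemilch's formula for the
   unsigned Stirling numbers c(n, j) of the first kind. For that, note that k \<mapsto> S(k+p, k) is given by
   a polynomial F of degree at most 2p whose value at -n is c(n, n-p) for n \<ge> 1 (the two recurrences
   are the same difference equation). F vanishes at -1, ..., -p, so Lagrange interpolation at
   -p, ..., p expresses F(-n) through S(k+p, k) with 0 \<le> k \<le> p only. *)
theory Submission
  imports Defs "HOL-Combinatorics.Stirling"
begin

subsection \<open>Reduction to ordinary Stirling numbers\<close>

lemma S2_hat_0: "S2_hat d a 0 k = (if k = 0 then 1 else 0)"
  by (simp add: S2_hat_def S2_0)

lemma S2_hat_Suc:
  assumes "d \<ge> 1"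
  shows "S2_hat d a (Suc l) k = (of_nat a + of_nat d * of_nat k) * S2_hat d a l k +
           (if k = 0 then 0 else S2_hat d a l (k - 1))"
  using assms by (cases k) (simp_all add: S2_hat_def S2_Suc field_simps)

text \<open>With E the shift of the sequence \<open>f\<close>, the sum is \<open>(x - E)^N\<close>
  applied to \<open>f\<close> and read off at 0. Pascal's rule peels off one factor
  \<open>x - E\<close>.\<close>

lemma binomial_transform_Suc:
  fixes f :: "nat \<Rightarrow> 'a::comm_ring_1"
  shows "(\<Sum>l\<le>Suc N. (- 1) ^ l * of_nat (Suc N choose l) * x ^ (Suc N - l) * f l) =
    x * (\<Sum>l\<le>N. (- 1) ^ l * of_nat (N choose l) * x ^ (N - l) * f l) -
    (\<Sum>l\<le>N. (- 1) ^ l * of_nat (N choose l) * x ^ (N - l) * f (Suc l))"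
proof -
  have 1: "(\<Sum>l\<le>Suc N. (- 1) ^ l * of_nat (N choose l) * x ^ (Suc N - l) * f l) =
      x * (\<Sum>l\<le>N. (- 1) ^ l * of_nat (N choose l) * x ^ (N - l) * f l)"
    by (simp add: sum_distrib_left Suc_diff_le binomial_eq_0 algebra_simps)
  have "(\<Sum>l\<le>Suc N. (- 1) ^ l * of_nat (Suc N choose l) * x ^ (Suc N - l) * f l) =
      x ^ Suc N * f 0 + (\<Sum>l\<le>N. (- 1) ^ Suc l * of_nat (Suc N choose Suc l) * x ^ (N - l) * f (Suc l))"
    by (subst sum.atMost_Suc_shift) simp
  also have "\<dots> = (x ^ Suc N * f 0 + (\<Sum>l\<le>N. (- 1) ^ Suc l * of_nat (N choose Suc l) * x ^ (N - l) * f (Suc l)))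
     + (\<Sum>l\<le>N. (- 1) ^ Suc l * of_nat (N choose l) * x ^ (N - l) * f (Suc l))"
    by (simp add: algebra_simps sum.distrib sum_negf sum_subtractf)
  also have "x ^ Suc N * f 0 + (\<Sum>l\<le>N. (- 1) ^ Suc l * of_nat (N choose Suc l) * x ^ (N - l) * f (Suc l))
      = (\<Sum>l\<le>Suc N. (- 1) ^ l * of_nat (N choose l) * x ^ (Suc N - l) * f l)"
    unfolding sum.atMost_Suc_shift [of _ N] by simp
  finally show ?thesis using 1 by (simp add: sum_negf)
qed

text \<open>In operator terms, with D the Euler operator, expanding \<open>(a - (a + d D))^N\<close>
  gives \<open>(- d D)^N\<close>, and the ordinary Stirling numbers are the normal-ordering
  coefficients of \<open>D^N\<close>. The factor \<open>d^k\<close> undoes the scaling of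
  \<open>S2_hat\<close>. The induction carries this out on the recurrences.\<close>

lemma binomial_transform_S2_hat:
  assumes "d \<ge> 1"
  shows "of_nat d ^ k * (\<Sum>l\<le>N. (- 1) ^ l * of_nat (N choose l) * of_nat a ^ (N - l) * S2_hat d a l k) =
         (- 1) ^ N * of_nat d ^ N * of_nat (Stirling N k)"
proof (induction N arbitrary: k)
  case 0
  then show ?case by (cases k) (simp_all add: S2_hat_0)
next
  case (Suc N)
  define T where "T k = (\<Sum>l\<le>N. (- 1) ^ l * of_nat (N choose l) * of_nat a ^ (N - l) * S2_hat d a l k)" for k
  have IH: "of_nat d ^ k * T k = (- 1) ^ N * of_nat d ^ N * of_nat (Stirling N k)" for k
    using Suc.IH by (simp add: T_def)
  have "(\<Sum>l\<le>N. (- 1) ^ l * of_nat (N choose l) * of_nat a ^ (N - l) * S2_hat d a (Suc l) k) =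
     (of_nat a + of_nat d * of_nat k) * T k + (if k = 0 then 0 else T (k - 1))"
    by (cases k) (simp_all add: S2_hat_Suc[OF assms] T_def sum_distrib_left sum.distrib algebra_simps)
  then have "(\<Sum>l\<le>Suc N. (- 1) ^ l * of_nat (Suc N choose l) * of_nat a ^ (Suc N - l) * S2_hat d a l k) =
     - (of_nat d * of_nat k * T k + (if k = 0 then 0 else T (k - 1)))"
    unfolding binomial_transform_Suc T_def [symmetric] by (simp add: algebra_simps)
  moreover have "of_nat d ^ k * (of_nat d * of_nat k * T k + (if k = 0 then 0 else T (k - 1))) =
      (- 1) ^ N * of_nat d ^ Suc N * of_nat (Stirling (Suc N) k)"
  proof (cases k)
    case (Suc i)
    have "of_nat d ^ k * (of_nat d * of_nat k * T k + T i) =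
       of_nat d * (of_nat k * (of_nat d ^ k * T k) + of_nat d ^ i * T i)"
      by (simp add: Suc algebra_simps)
    also have "\<dots> = (- 1) ^ N * of_nat d ^ Suc N * of_nat (Stirling (Suc N) k)"
      unfolding IH by (simp add: Suc algebra_simps)
    finally show ?thesis by (simp add: Suc)
  qed simp
  ultimately show ?case by (simp only: mult_minus_right) simp
qed

section \<open>The inverse matrix and first-kind numbers\<close>

text \<open>Up to the factor \<open>d^n\<close>, row n lists the coefficients of the product of the
  \<open>x - a - i d\<close> for i < n. This is an explicit candidate for the inverse
  matrix.\<close>

fun S1_rec :: "nat \<Rightarrow> nat \<Rightarrow> nat \<Rightarrow> nat \<Rightarrow> rat" where
  "S1_rec d a 0 m = (if m = 0 then 1 else 0)"
| "S1_rec d a (Suc n) m =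
     ((if m = 0 then 0 else S1_rec d a n (m - 1)) - (of_nat a + of_nat n * of_nat d) * S1_rec d a n m) / of_nat d"

lemma S1_rec_eq_0: "n < m \<Longrightarrow> S1_rec d a n m = 0"
  by (induction n arbitrary: m) auto

lemma lower_triangular_S1_rec: "lower_triangular (S1_rec d a)"
  by (simp add: lower_triangular_def S1_rec_eq_0)

lemma lt_mult_S1_rec_S2:
  assumes "d \<ge> 1"
  shows "lt_mult (S1_rec d a) (S2 d a) n m = id_mat n m"
proof (induction n arbitrary: m)
  case 0
  show ?case by (simp add: lt_mult_def id_mat_def S2_0)
next
  case (Suc n)
  let ?T = "S1_rec d a"
  have IH: "(\<Sum>k\<le>n. ?T n k * S2 d a k m) = id_mat n m" for m
    using Suc.IH by (simp add: lt_mult_def)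
  have "of_nat d * lt_mult ?T (S2 d a) (Suc n) m =
     (\<Sum>k\<le>Suc n. (if k = 0 then 0 else ?T n (k - 1)) * S2 d a k m) -
     (of_nat a + of_nat n * of_nat d) * (\<Sum>k\<le>Suc n. ?T n k * S2 d a k m)"
    using assms unfolding lt_mult_def sum_distrib_left sum_subtractf [symmetric]
    by (intro sum.cong refl) (simp add: field_simps)
  also have "(\<Sum>k\<le>Suc n. ?T n k * S2 d a k m) = id_mat n m"
    by (simp add: IH S1_rec_eq_0)
  also have "(\<Sum>k\<le>Suc n. (if k = 0 then 0 else ?T n (k - 1)) * S2 d a k m) =
      (\<Sum>k\<le>n. ?T n k * S2 d a (Suc k) m)"
    by (subst sum.atMost_Suc_shift) simp
  also have "\<dots> = (of_nat a + of_nat d * of_nat m) * (\<Sum>k\<le>n. ?T n k * S2 d a k m) +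
      (if m = 0 then 0 else of_nat d * (\<Sum>k\<le>n. ?T n k * S2 d a k (m - 1)))"
    by (cases m) (simp_all add: S2_Suc sum_distrib_left sum.distrib algebra_simps)
  \<comment> \<open>Where m = n the two factors \<open>a + d m\<close> and \<open>a + n d\<close>
    cancel, and elsewhere \<open>id_mat n m\<close> is zero. Only the shifted identity
    survives.\<close>
  also have "\<dots> - (of_nat a + of_nat n * of_nat d) * id_mat n m = of_nat d * id_mat (Suc n) m"
    unfolding IH by (cases m) (auto simp: id_mat_def)
  finally show ?case using assms by simp
qed

text \<open>A left inverse and a right inverse of the same matrix coincide by associativity, so
  knowing \<open>S1_rec\<close> as a left inverse suffices.\<close>

lemma S1_eq_S1_rec:
  assumes "d \<ge> 1"
  shows "S1 d a = S1_rec d a"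
proof -
  have S1: "lower_triangular (S1 d a)" "lt_mult (S2 d a) (S1 d a) = id_mat"
    using theI' [OF S1_ex1 [OF assms, of a]] by (simp_all add: S1_def)
  have T: "lt_mult (S1_rec d a) (S2 d a) = id_mat"
    using lt_mult_S1_rec_S2 [OF assms] by blast
  have "S1 d a = lt_mult (lt_mult (S1_rec d a) (S2 d a)) (S1 d a)"
    by (simp add: T lt_mult_id_left)
  also have "\<dots> = S1_rec d a"
    by (simp only: lt_mult_assoc [OF lower_triangular_S2] S1 lt_mult_id_right [OF lower_triangular_S1_rec])
  finally show ?thesis .
qed

lemma S1p_hat_0: "d \<ge> 1 \<Longrightarrow> S1p_hat d a 0 m = (if m = 0 then 1 else 0)"
  by (simp add: S1p_hat_def S1_eq_S1_rec)

text \<open>The factor \<open>d^n\<close> clears the divisions by d in \<open>S1_rec\<close>, and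
  the signs turn each \<open>x - a - i d\<close> into \<open>x + a + i d\<close>.\<close>

lemma S1p_hat_Suc:
  assumes "d \<ge> 1"
  shows "S1p_hat d a (Suc n) m = (of_nat a + of_nat n * of_nat d) * S1p_hat d a n m +
           (if m = 0 then 0 else S1p_hat d a n (m - 1))"
proof -
  \<comment> \<open>Truncated subtraction spoils the sign change for m > n, but there
    \<open>S1_rec\<close> is zero.\<close>
  have 1: "(- 1) ^ (Suc n - m) * S1_rec d a n m = - ((- 1) ^ (n - m) * S1_rec d a n m)"
    by (cases "m \<le> n") (simp_all add: Suc_diff_le S1_rec_eq_0)
  have 2: "of_nat d * S1_rec d a (Suc n) m =
      (if m = 0 then 0 else S1_rec d a n (m - 1)) - (of_nat a + of_nat n * of_nat d) * S1_rec d a n m"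
    using assms by simp
  have "S1p_hat d a (Suc n) m = of_nat d ^ n * (- 1) ^ (Suc n - m) * (of_nat d * S1_rec d a (Suc n) m)"
    using assms by (simp add: S1p_hat_def S1_eq_S1_rec del: S1_rec.simps)
  also have "\<dots> = of_nat d ^ n * ((- 1) ^ (Suc n - m) * (if m = 0 then 0 else S1_rec d a n (m - 1))
     - (of_nat a + of_nat n * of_nat d) * ((- 1) ^ (Suc n - m) * S1_rec d a n m))"
    unfolding 2 by (simp add: algebra_simps)
  finally show ?thesis
    unfolding 1 using assms by (cases m) (simp_all add: S1p_hat_def S1_eq_S1_rec algebra_simps)
qed

text \<open>The product of the \<open>x + a + i d\<close> is a rising factorial in
  \<open>x + a\<close> with step d. Its coefficient at \<open>(x + a)^j\<close> is
  \<open>d^(n - j)\<close> times an unsigned Stirling number, and each power is expanded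
  binomially.\<close>

lemma S1p_hat_eq_sum_stirling:
  assumes "d \<ge> 1"
  shows "S1p_hat d a n m =
    (\<Sum>j\<le>n. of_nat (j choose m) * of_nat a ^ (j - m) * of_nat d ^ (n - j) * of_nat (stirling n j))"
proof (induction n arbitrary: m)
  case 0
  then show ?case using assms by (cases m) (simp_all add: S1p_hat_0)
next
  case (Suc n)
  \<comment> \<open>The coefficient of \<open>x^m\<close> in \<open>(x + a)^j\<close>; the
    recurrence for \<open>w\<close> is multiplication by \<open>x + a\<close>.\<close>
  define w :: "nat \<Rightarrow> nat \<Rightarrow> rat" where "w j m = of_nat (j choose m) * of_nat a ^ (j - m)" for j m
  have w: "w (Suc j) m = of_nat a * w j m + (if m = 0 then 0 else w j (m - 1))" for j m
  proof (cases m)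
    case (Suc i)
    then show ?thesis
      by (cases "i < j") (simp_all add: w_def algebra_simps Suc_diff_Suc power_Suc [symmetric] del: power_Suc)
  qed (simp add: w_def)
  have IH: "S1p_hat d a n m = (\<Sum>j\<le>n. w j m * of_nat d ^ (n - j) * of_nat (stirling n j))" for m
    using Suc.IH by (simp add: w_def)
  have "(\<Sum>j\<le>Suc n. w j m * of_nat d ^ (Suc n - j) * of_nat (stirling (Suc n) j)) =
     (\<Sum>j\<le>n. w (Suc j) m * of_nat d ^ (n - j) * (of_nat n * of_nat (stirling n (Suc j)) + of_nat (stirling n j)))"
    by (subst sum.atMost_Suc_shift) simp
  also have "\<dots> = (\<Sum>j\<le>n. w (Suc j) m * of_nat d ^ (n - j) * (of_nat n * of_nat (stirling n (Suc j))))
      + (\<Sum>j\<le>n. w (Suc j) m * of_nat d ^ (n - j) * of_nat (stirling n j))"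
    by (simp add: algebra_simps sum.distrib)
  \<comment> \<open>The added term j = 0 is zero: either n = 0 or
    \<open>stirling n 0 = 0\<close>.\<close>
  also have "(\<Sum>j\<le>n. w (Suc j) m * of_nat d ^ (n - j) * (of_nat n * of_nat (stirling n (Suc j)))) =
      (\<Sum>j\<le>Suc n. w j m * of_nat d ^ (Suc n - j) * (of_nat n * of_nat (stirling n j)))"
    unfolding sum.atMost_Suc_shift [of _ n] by (cases "n = 0") simp_all
  also have "\<dots> = of_nat n * of_nat d * S1p_hat d a n m"
    by (simp add: IH sum_distrib_left Suc_diff_le algebra_simps)
  also have "(\<Sum>j\<le>n. w (Suc j) m * of_nat d ^ (n - j) * of_nat (stirling n j)) =
      of_nat a * S1p_hat d a n m + (if m = 0 then 0 else S1p_hat d a n (m - 1))"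
    unfolding w IH by (cases m) (simp_all add: sum_distrib_left sum.distrib algebra_simps)
  finally show ?case
    by (simp add: S1p_hat_Suc [OF assms] w_def algebra_simps)
qed

subsection \<open>Schloemilch's formula\<close>

text \<open>Both sides are polynomials in x of degree below \<open>card A\<close>. They agree on A,
  since at a node y only the summand k = y survives.\<close>

lemma poly_lagrange_interpolation:
  fixes p :: "'a::field poly"
  assumes "finite A" "degree p < card A"
  shows "poly p x = (\<Sum>k\<in>A. poly p k * (\<Prod>i\<in>A - {k}. (x - i) / (k - i)))"
proof -
  define L where "L = (\<Sum>k\<in>A. smult (poly p k) (\<Prod>i\<in>A - {k}. smult (1 / (k - i)) [:- i, 1:]))"
  have L: "poly L y = (\<Sum>k\<in>A. poly p k * (\<Prod>i\<in>A - {k}. (y - i) / (k - i)))" for y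
    by (simp add: L_def poly_sum poly_prod diff_divide_distrib)
  have "degree L \<le> card A - 1"
    unfolding L_def
  proof (intro degree_sum_le assms(1))
    fix k assume k: "k \<in> A"
    have "degree (\<Prod>i\<in>A - {k}. smult (1 / (k - i)) [:- i, 1:]) \<le>
        sum (degree \<circ> (\<lambda>i. smult (1 / (k - i)) [:- i, 1:])) (A - {k})"
      using assms(1) by (intro degree_prod_sum_le) simp
    also have "\<dots> \<le> (\<Sum>i\<in>A - {k}. 1)"
      by (intro sum_mono) simp
    also have "\<dots> = card A - 1"
      using k assms(1) by simp
    finally show "degree (smult (poly p k) (\<Prod>i\<in>A - {k}. smult (1 / (k - i)) [:- i, 1:])) \<le> card A - 1"
      using degree_smult_le order_trans by blast
  qed
  then have deg: "degree L < card A" using assms by linarith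
  have "poly p y = poly L y" if y: "y \<in> A" for y
  proof -
    have "(\<Prod>i\<in>A - {k}. (y - i) / (k - i)) = 0" if "k \<in> A - {y}" for k
      using that y assms(1) by (intro prod_zero) auto
    then have "(\<Sum>k\<in>A - {y}. poly p k * (\<Prod>i\<in>A - {k}. (y - i) / (k - i))) = 0"
      by (intro sum.neutral) simp
    moreover have "(\<Prod>i\<in>A - {y}. (y - i) / (y - i)) = 1"
      by (intro prod.neutral) auto
    ultimately show ?thesis
      using assms(1) y by (simp add: L sum.remove [of A y])
  qed
  then have "p = L" using assms(2) deg by (intro poly_eqI_degree)
  then show ?thesis using L by metis
qed

section \<open>Rising factorials and indefinite summation of polynomials\<close>

lemma degree_lead_coeff_pochhammer_X:
  "degree (pochhammer [:0, 1 :: 'a::field_char_0:] n) = n \<and> lead_coeff (pochhammer [:0, 1 :: 'a:] n) = 1"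
proof -
  have X: "[:0, 1:] + of_nat n = [:of_nat n, 1 :: 'a:]" for n
    by (simp add: of_nat_poly)
  show ?thesis
  proof (induction n)
    case (Suc n)
    then have "pochhammer [:0, 1 :: 'a:] n \<noteq> 0" by (metis leading_coeff_0_iff zero_neq_one)
    then have "degree (pochhammer [:0, 1 :: 'a:] n * [:of_nat n, 1:]) = Suc n"
      using Suc by (simp add: degree_mult_eq del: mult_pCons_right)
    moreover have "lead_coeff (pochhammer [:0, 1 :: 'a:] n * [:of_nat n, 1:]) = 1"
      unfolding lead_coeff_mult using conjunct2 [OF Suc.IH] by simp
    ultimately show ?case by (simp add: pochhammer_Suc X del: mult_pCons_right)
  qed simp
qed

lemmas degree_pochhammer_X [simp] = degree_lead_coeff_pochhammer_X [THEN conjunct1]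

lemma coeff_pochhammer_X: "coeff (pochhammer [:0, 1 :: 'a::field_char_0:] n) n = 1"
  using degree_lead_coeff_pochhammer_X [of n, where 'a = 'a] by simp

lemma poly_pochhammer_X: "poly (pochhammer [:0, 1:] n) x = pochhammer (x :: 'a::field_char_0) n"
  by (induction n) (simp_all add: pochhammer_Suc)

text \<open>Backward differences act on rising factorials as derivatives act on powers. Stripping
  the leading term in this basis lowers the degree.\<close>

lemma indefinite_sum_poly:
  fixes q :: "'a::field_char_0 poly"
  assumes "degree q \<le> n"
  shows "\<exists>p. degree p \<le> Suc n \<and> poly p 0 = 0 \<and> (\<forall>x. poly p x - poly p (x - 1) = poly q x)"
  using assms
proof (induction n arbitrary: q)
  case 0
  then obtain c where q: "q = [:c:]" by (auto elim: degree_eq_zeroE)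
  show ?case by (rule exI [of _ "[:0, c:]"]) (simp add: q algebra_simps)
next
  case (Suc n)
  define c where "c = coeff q (Suc n)"
  \<comment> \<open>The rising factorial is monic, so \<open>q'\<close> loses the coefficient at
    \<open>Suc n\<close>; \<open>M\<close> is the antidifference of the removed term.\<close>
  define q' where "q' = q - smult c (pochhammer [:0, 1:] (Suc n))"
  define M where "M = smult (c / of_nat (Suc (Suc n))) (pochhammer [:0, 1:] (Suc (Suc n)))"
  have "degree q' \<le> Suc n"
    unfolding q'_def using Suc.prems degree_smult_le [of c "pochhammer [:0, 1:] (Suc n)"]
    by (intro degree_diff_le) simp_all
  moreover have "coeff q' (Suc n) = 0"
    by (simp add: q'_def c_def coeff_pochhammer_X)
  ultimately have "degree q' \<le> n"
    by (metis degree_0 le_SucE le_zero_eq leading_coeff_0_iff nat.distinct(1))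
  then obtain p where p: "degree p \<le> Suc n" "poly p 0 = 0" "\<And>x. poly p x - poly p (x - 1) = poly q' x"
    using Suc.IH by blast
  have M: "poly M x - poly M (x - 1) = c * pochhammer x (Suc n)" for x
  proof -
    have "pochhammer x (Suc (Suc n)) - pochhammer (x - 1) (Suc (Suc n)) =
        of_nat (Suc (Suc n)) * pochhammer x (Suc n)"
      by (simp only: pochhammer_rec [of "x - 1"] pochhammer_Suc [of x "Suc n"]) (simp add: algebra_simps)
    then show ?thesis
      unfolding M_def poly_smult poly_pochhammer_X right_diff_distrib [symmetric]
      by (simp del: of_nat_Suc)
  qed
  show ?case
  proof (intro exI conjI allI)
    show "degree (p + M) \<le> Suc (Suc n)"
      using p(1) by (intro degree_add_le) (simp_all add: M_def)
    show "poly (p + M) 0 = 0" by (simp add: p(2) M_def poly_pochhammer_X pochhammer_0_left)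
    fix x
    show "poly (p + M) x - poly (p + M) (x - 1) = poly q x"
      using p(3) [of x] M [of x] by (simp add: q'_def poly_pochhammer_X algebra_simps)
  qed
qed

section \<open>Stirling polynomials\<close>

text \<open>The difference equation is the recurrence of S(k + p, k) in k, with x in place of k.
  Multiplying by x and summing each raise the degree by at most one.\<close>

lemma ex_stirling_poly:
  "\<exists>F :: nat \<Rightarrow> rat poly. F 0 = 1 \<and> (\<forall>p. degree (F p) \<le> 2 * p \<and> poly (F (Suc p)) 0 = 0 \<and>
     (\<forall>x. poly (F (Suc p)) x - poly (F (Suc p)) (x - 1) = x * poly (F p) x))"
proof -
  \<comment> \<open>Fixing one antidifference per polynomial by choice gives a function that can be
    iterated.\<close>
  define step :: "rat poly \<Rightarrow> rat poly" where "step q = (SOME p. degree p \<le> degree q + 2 \<and> poly p 0 = 0 \<and>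
      (\<forall>x. poly p x - poly p (x - 1) = x * poly q x))" for q
  have step: "degree (step q) \<le> degree q + 2 \<and> poly (step q) 0 = 0 \<and>
      (\<forall>x. poly (step q) x - poly (step q) (x - 1) = x * poly q x)" for q
  proof -
    have "degree ([:0, 1:] * q) \<le> Suc (degree q)" by (simp add: degree_pCons_le)
    from indefinite_sum_poly [OF this] obtain p where "degree p \<le> Suc (Suc (degree q))" "poly p 0 = 0"
      "\<And>x. poly p x - poly p (x - 1) = poly ([:0, 1:] * q) x" by blast
    then have "\<exists>p. degree p \<le> degree q + 2 \<and> poly p 0 = 0 \<and> (\<forall>x. poly p x - poly p (x - 1) = x * poly q x)"
      by (intro exI [of _ p]) simp
    then show ?thesis
      unfolding step_def by (rule someI_ex)
  qed
  define F where "F p = (step ^^ p) 1" for p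
  have "degree (F p) \<le> 2 * p" for p
  proof (induction p)
    case (Suc p)
    have "degree (F (Suc p)) \<le> degree (F p) + 2" using step by (simp add: F_def)
    with Suc show ?case by simp
  qed (simp add: F_def)
  then show ?thesis
    by (intro exI [of _ F]) (use step in \<open>simp add: F_def\<close>)
qed

text \<open>Part of a Lagrange denominator: factors with i < k give \<open>fact k\<close>, those
  with i > k give the sign and \<open>fact (p - k)\<close>.\<close>

lemma prod_diff_nodes:
  fixes k p :: nat
  assumes "k \<le> p"
  shows "(\<Prod>i\<in>{..p} - {k}. of_nat k - of_nat i :: rat) = (- 1) ^ (p - k) * fact k * fact (p - k)"
proof -
  have split: "{..p} - {k} = {..<k} \<union> {k<..p}" using assms by auto
  have "(\<Prod>i\<in>{..p} - {k}. of_nat k - of_nat i :: rat) =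
     (\<Prod>i<k. of_nat k - of_nat i) * (\<Prod>i\<in>{k<..p}. of_nat k - of_nat i)"
    unfolding split by (rule prod.union_disjoint) auto
  also have "(\<Prod>i<k. of_nat k - of_nat i :: rat) = (\<Prod>i<k. of_nat (k - i))"
    by (intro prod.cong) (simp_all add: of_nat_diff)
  also have "\<dots> = fact k"
    by (simp add: fact_prod_rev lessThan_atLeast0)
  also have "(\<Prod>i\<in>{k<..p}. of_nat k - of_nat i :: rat) = (\<Prod>i\<in>{1..p - k}. - of_nat i)"
    by (rule prod.reindex_bij_witness [of _ "\<lambda>i. i + k" "\<lambda>i. i - k"]) (auto simp: of_nat_diff)
  also have "\<dots> = (- 1) ^ (p - k) * fact (p - k)"
    by (simp add: prod_uminus fact_prod)
  finally show ?thesis by simp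
qed


text \<open>Read upwards from 0, the difference equation is the recurrence of the second kind. Read
  downwards at -n, it is c(n + 1, n - p) = n c(n, n - p) + c(n, n - p - 1), that of the first
  kind.\<close>

lemma ex_stirling_poly_values:
  "\<exists>F :: rat poly. degree F \<le> 2 * p \<and> (\<forall>k. poly F (of_nat k) = of_nat (Stirling (k + p) k)) \<and>
     (\<forall>n \<ge> 1. poly F (- of_nat n) = (if p \<le> n then of_nat (stirling n (n - p)) else 0))"
proof -
  obtain F :: "nat \<Rightarrow> rat poly" where F0: "F 0 = 1" and deg: "\<And>p. degree (F p) \<le> 2 * p"
    and zero: "\<And>p. poly (F (Suc p)) 0 = 0"
    and diff: "\<And>p x. poly (F (Suc p)) x - poly (F (Suc p)) (x - 1) = x * poly (F p) x"
    using ex_stirling_poly by blast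
  have "poly (F p) (of_nat k) = of_nat (Stirling (k + p) k)" for k
  proof (induction p arbitrary: k)
    case (Suc p)
    show ?case
    proof (induction k)
      case (Suc k)
      have "poly (F (Suc p)) (of_nat (Suc k)) =
          poly (F (Suc p)) (of_nat k) + of_nat (Suc k) * poly (F p) (of_nat (Suc k))"
        using diff [of p "of_nat (Suc k)"] by (simp add: algebra_simps)
      then show ?case
        unfolding Suc.IH \<open>\<And>k. poly (F p) (of_nat k) = of_nat (Stirling (k + p) k)\<close>
        by (simp add: algebra_simps)
    qed (simp add: zero)
  qed (simp add: F0)
  moreover have "poly (F p) (- of_nat n) = (if p \<le> n then of_nat (stirling n (n - p)) else 0)"
    if "n \<ge> 1" for n
    using that
  proof (induction p arbitrary: n)
    case (Suc p)
    note IHp = Suc.IH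
    have step: "poly (F (Suc p)) (- of_nat (Suc n)) =
        poly (F (Suc p)) (- of_nat n) + of_nat n * poly (F p) (- of_nat n)" for n
    proof -
      have "- of_nat (Suc n) = (- of_nat n - 1 :: rat)" by simp
      then show ?thesis using diff [of p "- of_nat n"] by (simp only:)
    qed
    from Suc.prems show ?case
    proof (induction n rule: dec_induct)
      case base
      \<comment> \<open>The step from 0 to -1 carries the factor 0, so the value at -1 is the value
        at 0.\<close>
      show ?case using step [of 0] zero [of p] by simp
    next
      case (step n)
      show ?case
        unfolding \<open>\<And>n. poly (F (Suc p)) (- of_nat (Suc n)) = _\<close> step.IH IHp [OF step.hyps(1)]
      proof (cases "n \<le> p")
        case True
        then show "(if Suc p \<le> n then of_nat (stirling n (n - Suc p)) else 0) +
            of_nat n * (if p \<le> n then of_nat (stirling n (n - p)) else 0) =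
            (if Suc p \<le> Suc n then rat_of_nat (stirling (Suc n) (Suc n - Suc p)) else 0)"
          using step.hyps by (cases "n = p") auto
      next
        case False
        \<comment> \<open>This removes the truncated subtractions: n - p becomes
          \<open>Suc j\<close>, and the recurrence of \<open>stirling\<close> applies.\<close>
        then obtain j where j: "n = Suc (j + p)" by (metis less_iff_Suc_add not_le add.commute)
        then show "(if Suc p \<le> n then of_nat (stirling n (n - Suc p)) else 0) +
            of_nat n * (if p \<le> n then of_nat (stirling n (n - p)) else 0) =
            (if Suc p \<le> Suc n then rat_of_nat (stirling (Suc n) (Suc n - Suc p)) else 0)"
          by (simp add: Suc_diff_le algebra_simps)
      qed
    qed
  qed (simp add: F0)
  ultimately show ?thesis using deg by blast
qed

section \<open>Evaluation of the interpolation formula\<close>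

text \<open>Degree at most 2p allows interpolation at the 2p + 1 nodes -p, ..., p. The signed
  factorial quotient is the Lagrange weight of the node k at the point -n.\<close>

lemma schloemilch_factorial:
  assumes "p < n"
  shows "rat_of_nat (stirling n (n - p)) = (\<Sum>k\<le>p. of_nat (Stirling (k + p) k) *
     ((- 1) ^ (p + k) * (fact (n + p) / (fact (k + p) * fact (n - p - 1) * of_nat (n + k) * fact (p - k)))))"
proof -
  obtain F :: "rat poly" where deg: "degree F \<le> 2 * p"
    and pos: "\<And>k. poly F (of_nat k) = of_nat (Stirling (k + p) k)"
    and neg: "\<And>n. n \<ge> 1 \<Longrightarrow> poly F (- of_nat n) = (if p \<le> n then of_nat (stirling n (n - p)) else 0)"
    using ex_stirling_poly_values by blast
  define P N :: "rat set" where "P = of_nat ` {..p}" and "N = (\<lambda>i. - of_nat i) ` {1..p}"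
  have inj: "inj_on (of_nat :: nat \<Rightarrow> rat) S" "inj_on (\<lambda>i::nat. - of_nat i :: rat) S" for S
    by (auto simp: inj_on_def)
  have disj: "P \<inter> N = {}"
  proof -
    have "of_nat i \<noteq> (- of_nat j :: rat)" if "j \<ge> 1" for i j :: nat
      using that by (metis add_eq_0_iff_both_eq_0 eq_neg_iff_add_eq_0 not_one_le_zero of_nat_add of_nat_eq_0_iff)
    then show ?thesis by (auto simp: P_def N_def)
  qed
  have fin: "finite P" "finite N" by (auto simp: P_def N_def)
  have "card P = Suc p" "card N = p"
    unfolding P_def N_def by (simp_all add: card_image inj)
  then have "card (P \<union> N) = 2 * p + 1"
    using card_Un_disjoint [OF fin disj] by simp
  then have "degree F < card (P \<union> N)" using deg by simp
  then have "poly F (- of_nat n) =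
      (\<Sum>k\<in>P \<union> N. poly F k * (\<Prod>i\<in>P \<union> N - {k}. (- of_nat n - i) / (k - i)))"
    using fin by (intro poly_lagrange_interpolation) auto
  also have "\<dots> = (\<Sum>k\<in>P. poly F k * (\<Prod>i\<in>P \<union> N - {k}. (- of_nat n - i) / (k - i)))"
  proof (rule sum.mono_neutral_right)
    \<comment> \<open>At -i with i < p the default value 0 applies; at -p the value is
      \<open>stirling p 0\<close>, zero because p is positive here.\<close>
    show "\<forall>k\<in>P \<union> N - P. poly F k * (\<Prod>i\<in>P \<union> N - {k}. (- of_nat n - i) / (k - i)) = 0"
      by (auto simp: N_def neg)
  qed (use fin in auto)
  also have "\<dots> = (\<Sum>k\<le>p. of_nat (Stirling (k + p) k) *
      (\<Prod>i\<in>P \<union> N - {of_nat k}. (- of_nat n - i) / (of_nat k - i)))"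
    unfolding P_def by (subst sum.reindex) (simp_all add: inj pos)
  also have "\<dots> = (\<Sum>k\<le>p. of_nat (Stirling (k + p) k) *
     ((- 1) ^ (p + k) * (fact (n + p) / (fact (k + p) * fact (n - p - 1) * of_nat (n + k) * fact (p - k)))))"
  proof (intro sum.cong refl arg_cong2 [of _ _ _ _ "(*)"])
    fix k assume "k \<in> {..p}"
    then have k: "k \<le> p" by simp
    have split: "P \<union> N - {of_nat k} = of_nat ` ({..p} - {k}) \<union> N"
      using disj k by (auto simp: P_def)
    have "(\<Prod>i\<in>P \<union> N - {of_nat k}. (- of_nat n - i) / (of_nat k - i)) =
       (\<Prod>i\<in>of_nat ` ({..p} - {k}). (- of_nat n - i) / (of_nat k - i)) *
       (\<Prod>i\<in>N. (- of_nat n - i) / (of_nat k - i))"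
      unfolding split using disj fin by (intro prod.union_disjoint) (auto simp: P_def)
    also have "(\<Prod>i\<in>of_nat ` ({..p} - {k}). (- of_nat n - i) / (of_nat k - i :: rat)) =
       (\<Prod>i\<in>{..p} - {k}. - of_nat (n + i)) / (\<Prod>i\<in>{..p} - {k}. of_nat k - of_nat i)"
      by (subst prod.reindex) (simp_all add: inj prod_dividef minus_diff_commute)
    also have "(\<Prod>i\<in>{..p} - {k}. - of_nat (n + i) :: rat) = (- 1) ^ p * (\<Prod>i\<in>{..p} - {k}. of_nat (n + i))"
      using k by (simp only: prod_uminus) simp
    \<comment> \<open>Restoring the missing factor n + k completes the product to
      \<open>fact (n + p) / fact (n - 1)\<close>.\<close>
    also have "(\<Prod>i\<in>{..p} - {k}. of_nat (n + i) :: rat) = fact (n + p) / (fact (n - 1) * of_nat (n + k))"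
    proof -
      have "(\<Prod>i\<le>p. of_nat (n + i) :: rat) = of_nat (n + k) * (\<Prod>i\<in>{..p} - {k}. of_nat (n + i))"
        using k by (simp add: prod.remove)
      moreover have "fact (n - 1) * (\<Prod>i\<le>p. of_nat (n + i) :: rat) = fact (n + p)"
      proof -
        obtain i where n: "n = Suc i" using assms by (cases n) auto
        show ?thesis unfolding n
        proof (induction p)
          case (Suc p)
          have "fact (Suc i - 1) * (\<Prod>j\<le>Suc p. of_nat (Suc i + j)) =
              of_nat (Suc i + Suc p) * (fact (Suc i - 1) * (\<Prod>j\<le>p. of_nat (Suc i + j)) :: rat)"
            by (simp only: prod.atMost_Suc mult_ac)
          then show ?case unfolding Suc.IH by (simp only: add_Suc_right fact_Suc)
        qed simp
      qed
      ultimately have "fact (n + p) =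
          fact (n - 1) * of_nat (n + k) * (\<Prod>i\<in>{..p} - {k}. of_nat (n + i) :: rat)"
        by (simp only: mult.assoc)
      then show ?thesis using assms by (simp del: of_nat_add)
    qed
    also have "(\<Prod>i\<in>{..p} - {k}. of_nat k - of_nat i :: rat) = (- 1) ^ (p - k) * fact k * fact (p - k)"
      using k by (rule prod_diff_nodes)
    also have "(\<Prod>i\<in>N. (- of_nat n - i) / (of_nat k - i)) =
       (\<Prod>i\<in>{1..p}. of_nat i - of_nat n) / (\<Prod>i\<in>{1..p}. of_nat (k + i))"
      unfolding N_def by (subst prod.reindex) (simp_all add: inj prod_dividef)
    \<comment> \<open>All p factors are negative since p < n; their absolute values run from n - 1
      down to n - p.\<close>
    also have "(\<Prod>i\<in>{1..p}. of_nat i - of_nat n :: rat) = (- 1) ^ p * (fact (n - 1) / fact (n - p - 1))"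
    proof -
      have "(\<Prod>i\<in>{1..p}. of_nat i - of_nat n :: rat) = (\<Prod>i\<in>{1..p}. - of_nat (n - i))"
        using assms by (intro prod.cong) (auto simp: of_nat_diff)
      also have "\<dots> = (- 1) ^ p * (\<Prod>i\<in>{1..p}. of_nat (n - i))"
        by (simp add: prod_uminus)
      also have "(\<Prod>i\<in>{1..p}. of_nat (n - i)) = (fact (n - 1) / fact (n - p - 1) :: rat)"
        using assms
      proof (induction p)
        case (Suc p)
        have "fact (n - p - 1) = (of_nat (n - Suc p) * fact (n - Suc p - 1) :: rat)"
          using Suc.prems by (subst fact_num_eq_if) simp
        moreover have "(\<Prod>i\<in>{1..p}. of_nat (n - i)) = (fact (n - 1) / fact (n - p - 1) :: rat)"
          using Suc by simp
        moreover have "rat_of_nat (n - Suc p) \<noteq> 0"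
          using Suc.prems by simp
        ultimately show ?case by (simp add: prod.nat_ivl_Suc' del: of_nat_diff)
      qed simp
      finally show ?thesis .
    qed
    also have "(\<Prod>i\<in>{1..p}. of_nat (k + i)) = (fact (k + p) / fact k :: rat)"
    proof -
      have "fact k * (\<Prod>i\<in>{1..p}. of_nat (k + i)) = (fact (k + p) :: rat)"
      proof (induction p)
        case (Suc p)
        have "fact k * (\<Prod>i\<in>{1..Suc p}. of_nat (k + i)) =
            of_nat (k + Suc p) * (fact k * (\<Prod>i\<in>{1..p}. of_nat (k + i)) :: rat)"
          by (simp add: prod.nat_ivl_Suc' mult_ac del: of_nat_add)
        then show ?case unfolding Suc.IH by (simp only: add_Suc_right fact_Suc)
      qed simp
      then show ?thesis by (metis fact_nonzero nonzero_mult_div_cancel_left)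
    qed
    finally have "(\<Prod>i\<in>P \<union> N - {of_nat k}. (- of_nat n - i) / (of_nat k - i)) =
       (- 1) ^ p * (fact (n + p) / (fact (n - 1) * of_nat (n + k))) / ((- 1) ^ (p - k) * fact k * fact (p - k)) *
       ((- 1) ^ p * (fact (n - 1) / fact (n - p - 1)) / (fact (k + p) / fact k))" .
    also have "\<dots> = ((- 1) ^ p * (- 1) ^ p / (- 1) ^ (p - k)) *
      (fact (n + p) / (fact (k + p) * fact (n - p - 1) * of_nat (n + k) * fact (p - k)))"
      by (simp add: divide_simps)
    also have "(- 1) ^ p * (- 1) ^ p / (- 1) ^ (p - k) = ((- 1) ^ (p + k) :: rat)"
      using k by (auto simp: minus_one_power_iff)
    finally show "(\<Prod>i\<in>P \<union> N - {of_nat k}. (- of_nat n - i) / (of_nat k - i)) =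
      (- 1) ^ (p + k) * (fact (n + p) / (fact (k + p) * fact (n - p - 1) * of_nat (n + k) * fact (p - k)))" .
  qed
  finally show ?thesis using neg [of n] assms by simp
qed

text \<open>With p = n - j, splitting \<open>fact (n + k)\<close> as n + k times
  \<open>fact (n + k - 1)\<close> turns the weight into two binomial coefficients. The bound 1 \<le>
  j ensures p < n.\<close>

lemma schloemilch:
  assumes "1 \<le> j" "j \<le> n"
  shows "rat_of_nat (stirling n j) = (\<Sum>k\<le>n - j. (- 1) ^ (n - j + k) *
     of_nat ((n + k - 1) choose (j - 1)) * of_nat ((2 * n - j) choose (n - j - k)) * of_nat (Stirling (n - j + k) k))"
proof -
  define p where "p = n - j"
  have p: "p < n" "j = n - p" using assms by (auto simp: p_def)
  have factorials: "fact (n + p) / (fact (k + p) * fact (n - p - 1) * of_nat (n + k) * fact (p - k)) =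
     rat_of_nat ((n + k - 1) choose (j - 1)) * of_nat ((2 * n - j) choose (n - j - k))" if "k \<le> p" for k
  proof -
    have 1: "n + k - 1 - (j - 1) = k + p" "2 * n - j = n + p" "n + p - (p - k) = n + k" "n - j = p"
      using assms p that by auto
    have "rat_of_nat ((n + k - 1) choose (j - 1)) = fact (n + k - 1) / (fact (n - p - 1) * fact (k + p))"
      using p by (subst binomial_fact) (auto simp: 1)
    moreover have "rat_of_nat ((2 * n - j) choose (n - j - k)) = fact (n + p) / (fact (p - k) * fact (n + k))"
      unfolding 1 using p that by (subst binomial_fact) (auto simp: 1)
    moreover have "fact (n + k) = (of_nat (n + k) * fact (n + k - 1) :: rat)"
      using p by (subst fact_num_eq_if) simp
    ultimately show ?thesis by simp
  qed
  have "rat_of_nat (stirling n j) = (\<Sum>k\<le>p. (- 1) ^ (p + k) *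
     of_nat ((n + k - 1) choose (j - 1)) * of_nat ((2 * n - j) choose (n - j - k)) * of_nat (Stirling (p + k) k))"
    unfolding p(2) schloemilch_factorial [OF p(1)]
  proof (intro sum.cong refl)
    fix k assume "k \<in> {..p}"
    then show "of_nat (Stirling (k + p) k) *
       ((- 1) ^ (p + k) * (fact (n + p) / (fact (k + p) * fact (n - p - 1) * of_nat (n + k) * fact (p - k)))) =
       (- 1) ^ (p + k) * of_nat ((n + k - 1) choose (n - p - 1)) *
         of_nat ((2 * n - (n - p)) choose (n - (n - p) - k)) * rat_of_nat (Stirling (p + k) k)"
      using factorials [of k] unfolding p(2) by (simp add: add.commute [of k p])
  qed
  then show ?thesis by (simp only: p_def)
qed

subsection \<open>The expansion\<close>

text \<open>Within the summation ranges the combined exponent is nonnegative, so the splitting also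
  holds at a = 0.\<close>

lemma power_eq_powi_shift:
  assumes "m \<le> j" "j \<le> n" "l \<le> n - j + k"
  shows "(a :: 'a::field) powi (int n - int m + int k - int l) = a ^ (j - m) * a ^ (n - j + k - l)"
proof -
  have "int n - int m + int k - int l = int (j - m + (n - j + k - l))" using assms by linarith
  then show ?thesis by (simp only: power_int_of_nat power_add)
qed

text \<open>With the powers of a combined, one formula covers a = 0 and a > 0 alike.\<close>

lemma S1p_hat_expansion:
  assumes "d \<ge> 1" and "m \<le> n" and "n \<noteq> 0"
  shows "S1p_hat d a n m =
    (\<Sum>j = m..n. of_nat (j choose m) *
      (\<Sum>k = 0..n - j. binom (int n + int k - 1) (int j - 1) *
        of_nat ((2 * n - j) choose (n - j - k)) *
        (\<Sum>l = 0..n - j + k. (- 1) ^ l * of_nat ((n - j + k) choose l) *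
          of_nat a powi (int n - int m + int k - int l) * S2_hat d a l k)))"
proof -
  have "S1p_hat d a n m = (\<Sum>j = m..n. of_nat (j choose m) *
      (of_nat a ^ (j - m) * (of_nat d ^ (n - j) * of_nat (stirling n j))))"
    unfolding S1p_hat_eq_sum_stirling [OF assms(1)] mult.assoc
    by (rule sum.mono_neutral_right) (auto simp: binomial_eq_0)
  also have "\<dots> = (\<Sum>j = m..n. of_nat (j choose m) *
      (\<Sum>k = 0..n - j. binom (int n + int k - 1) (int j - 1) *
        of_nat ((2 * n - j) choose (n - j - k)) *
        (\<Sum>l = 0..n - j + k. (- 1) ^ l * of_nat ((n - j + k) choose l) *
          of_nat a powi (int n - int m + int k - int l) * S2_hat d a l k)))"
  proof (intro sum.cong refl arg_cong2 [of _ _ _ _ "(*)"])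
    fix j assume "j \<in> {m..n}"
    then have j: "m \<le> j" "j \<le> n" by auto
    \<comment> \<open>The binomial transform with N = n - j + k; dividing \<open>d^N\<close> by
      \<open>d^k\<close> leaves \<open>d^(n - j)\<close>.\<close>
    have inner: "(\<Sum>l = 0..n - j + k. (- 1) ^ l * of_nat ((n - j + k) choose l) *
          of_nat a powi (int n - int m + int k - int l) * S2_hat d a l k) =
        of_nat a ^ (j - m) * ((- 1) ^ (n - j + k) * of_nat d ^ (n - j) * of_nat (Stirling (n - j + k) k))" for k
    proof -
      have "(\<Sum>l = 0..n - j + k. (- 1) ^ l * of_nat ((n - j + k) choose l) *
          of_nat a powi (int n - int m + int k - int l) * S2_hat d a l k) =
        of_nat a ^ (j - m) * (\<Sum>l\<le>n - j + k. (- 1) ^ l * of_nat ((n - j + k) choose l) *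
          of_nat a ^ (n - j + k - l) * S2_hat d a l k)"
        unfolding sum_distrib_left atMost_atLeast0
        using j by (intro sum.cong refl) (simp add: power_eq_powi_shift)
      moreover have "(\<Sum>l\<le>n - j + k. (- 1) ^ l * of_nat ((n - j + k) choose l) *
          of_nat a ^ (n - j + k - l) * S2_hat d a l k) =
          (- 1) ^ (n - j + k) * of_nat d ^ (n - j) * of_nat (Stirling (n - j + k) k)"
        using binomial_transform_S2_hat [OF assms(1), of k "n - j + k" a] assms(1)
        by (simp add: power_add field_simps)
      ultimately show ?thesis by simp
    qed
    show "of_nat a ^ (j - m) * (of_nat d ^ (n - j) * of_nat (stirling n j)) =
      (\<Sum>k = 0..n - j. binom (int n + int k - 1) (int j - 1) *
        of_nat ((2 * n - j) choose (n - j - k)) *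
        (\<Sum>l = 0..n - j + k. (- 1) ^ l * of_nat ((n - j + k) choose l) *
          of_nat a powi (int n - int m + int k - int l) * S2_hat d a l k))"
    \<comment> \<open>For j = 0 the right side vanishes because the lower argument of
      \<open>binom\<close> is -1, and the left side because \<open>stirling n 0 = 0\<close> for n
      \<noteq> 0.\<close>
    proof (cases "j = 0")
      case True
      then show ?thesis using assms(3) by (simp add: binom_def)
    next
      case False
      have binom: "binom (int n + int k - 1) (int j - 1) = of_nat ((n + k - 1) choose (j - 1))" for k
      proof -
        have 1: "int n + int k - 1 = int (n + k - 1)" "int j - 1 = int (j - 1)"
          using False assms(3) by auto
        show ?thesis unfolding 1 by (simp add: binom_def binomial_gbinomial)
      qed
      have "1 \<le> j" using False by simp
      then show ?thesis
        unfolding inner binom schloemilch [OF \<open>1 \<le> j\<close> j(2)] atMost_atLeast0 sum_distrib_left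
        by (intro sum.cong refl) (simp only: mult_ac)
    qed
  qed
  finally show ?thesis .
qed

theorem mainTheorem19:
  fixes d a n m :: nat
  assumes "d \<ge> 1" and "m \<le> n" and "(n, m) \<noteq> (0, 0)"
  shows "(a > 0 \<longrightarrow>
           S1p_hat d a n m =
             of_nat a ^ (n - m) *
             (\<Sum>j = m..n. of_nat (j choose m) *
               (\<Sum>k = 0..n - j. binom (int n + int k - 1) (int j - 1) *
                  of_nat ((2 * n - j) choose (n - j - k)) * of_nat a ^ k *
                  (\<Sum>l = 0..n - j + k. (- 1) ^ l * of_nat ((n - j + k) choose l) *
                     of_nat a powi (- int l) * S2_hat d a l k)))) \<and>
         (a = 0 \<longrightarrow>
           S1p_hat d a n m =
             (\<Sum>j = m..n. of_nat (j choose m) *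
               (\<Sum>k = 0..n - j. binom (int n + int k - 1) (int j - 1) *
                  of_nat ((2 * n - j) choose (n - j - k)) *
                  (\<Sum>l = 0..n - j + k. (- 1) ^ l * of_nat ((n - j + k) choose l) *
                     of_nat a powi (int n - int m + int k - int l) * S2_hat d a l k))))"
proof -
  have n: "n \<noteq> 0" using assms by auto
  \<comment> \<open>Splitting off the negative power of a requires a to be nonzero, hence the
    separate form for a = 0.\<close>
  have powi: "of_nat a powi (int n - int m + int k - int l) =
      (of_nat a ^ (n - m) * (of_nat a ^ k * of_nat a powi (- int l)) :: rat)" if "a > 0" for k l
  proof -
    have "int n - int m + int k - int l = int (n - m) + int k + (- int l)"
      using assms(2) by (simp add: of_nat_diff)
    then have "of_nat a powi (int n - int m + int k - int l) =
        (of_nat a powi (int (n - m) + int k + (- int l)) :: rat)" by (rule arg_cong)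
    also have "\<dots> = of_nat a powi int (n - m) * of_nat a powi int k * of_nat a powi (- int l)"
      using that by (subst power_int_add, simp)+ (rule refl)
    finally show ?thesis by (simp only: power_int_of_nat mult.assoc)
  qed
  show ?thesis
    unfolding S1p_hat_expansion [OF assms(1,2) n]
    by (intro conjI impI) (simp_all add: powi sum_distrib_left mult_ac)
qed

end
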